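(* Let $d\ge 1$ and let $p(t)=a_0+a_1t+\cdots+a_dt^d\in\mathbb R[t]$ have degree $d$ with $a_0\neq0$. Let $V_{p(t)}$ be the $(d+1)\times(d+1)$ circulant matrix whose $i$-th row ($i=0,\dots,d$) is $T^i(a_d,a_{d-1},\dots,a_0)$, where $T(x_d,x_{d-1},\dots,x_1,x_0)=(x_0,x_d,\dots,x_1)$. Let $\xi=e^{2\pi i/(d+1)}$ and, for $k=0,\dots,d$, let $\lambda_k=\xi^{dk}p(\xi^{-k})$ (the eigenvalues of $V_{p(t)}$). Then for every integer $n\ge0$, $$V_{p(t)}^n\begin{pmatrix}a_0\\ a_1\\ \vdots\\ a_{d-1}\\ a_d\end{pmatrix}=\frac{1}{d+1}\begin{pmatrix} 1 & \xi & \cdots & \xi^{d-1} & \xi^d\\ 1 & \xi^2 & \cdots & \xi^{2(d-1)} & \xi^{2d}\\ \vdots & \vdots & \ddots & \vdots & \vdots\\ 1 & \xi^d & \cdots & \xi^{(d-1)d} & \xi^{d^2}\\ 1 & 1 & \cdots & 1 & 1 \end{pmatrix}\begin{pmatrix}\lambda_0^{n+1}\\ \lambda_1^{n+1}\\ \vdots\\ \lambda_{d-1}^{n+1}\\ \lambda_d^{n+1}\end{pmatrix},$$ i.e. the $(j+1)$-st entry ($j=0,\dots,d$) of the left side equals $\frac{1}{d+1}\sum_{k=0}^d \xi^{(j+1)k}\lambda_k^{n+1}$. *)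

theory Defs
  imports Complex_Main "HOL-Computational_Algebra.Polynomial" "Jordan_Normal_Form.Matrix"
begin

text \<open>The cyclic shift $T(x_d, x_{d-1}, \dots, x_1, x_0) = (x_0, x_d, \dots, x_1)$. Vector positions
  are counted from the left starting at 0, so position $i$ of the argument holds $x_{d-i}$.\<close>

definition cyclic_shift :: "'a vec \<Rightarrow> 'a vec" where
  "cyclic_shift x = vec (dim_vec x) (\<lambda>i. if i = 0 then x $ (dim_vec x - 1) else x $ (i - 1))"

definition coeff_vec :: "real poly \<Rightarrow> real vec" where
  "coeff_vec p = vec (degree p + 1) (\<lambda>i. coeff p i)"

definition rev_coeff_vec :: "real poly \<Rightarrow> real vec" where
  "rev_coeff_vec p = vec (degree p + 1) (\<lambda>i. coeff p (degree p - i))"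

definition circulant_mat :: "real poly \<Rightarrow> real mat" where
  "circulant_mat p =
     mat\<^sub>r (degree p + 1) (degree p + 1) (\<lambda>i. (cyclic_shift ^^ i) (rev_coeff_vec p))"

definition root_xi :: "nat \<Rightarrow> complex" where
  "root_xi d = exp (2 * of_real pi * \<i> / of_nat (d + 1))"

definition circ_eigenvalue :: "real poly \<Rightarrow> nat \<Rightarrow> complex" where
  "circ_eigenvalue p k =
     root_xi (degree p) ^ (degree p * k) *
     poly (map_poly complex_of_real p) (root_xi (degree p) powi (- int k))"

text \<open>Rows and columns are indexed from 0; the last row ($j = d$) consists of ones,
  since $\xi^{(d+1)k} = 1$.\<close>

definition xi_mat :: "nat \<Rightarrow> complex mat" where
  "xi_mat d = mat (d + 1) (d + 1) (\<lambda>(j, k). root_xi d ^ ((j + 1) * k))"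

end

theory Submission imports Defs begin

text \<open>With \<open>\<omega> = \<xi>\<^sup>k\<close>, the vector \<open>(\<omega>, \<omega>\<^sup>2, \<dots>, \<omega>\<^bsup>d+1\<^esup>)\<close> is an eigenvector of the circulant
  matrix for the eigenvalue \<open>\<lambda>\<^sub>k = (\<Sum>m\<le>d. a\<^sub>m \<omega>\<^bsup>d-m\<^esup>)\<close>. Orthogonality of the characters of the
  cyclic group of order \<open>d+1\<close> expands the coefficient vector in these eigenvectors, the \<open>k\<close>-th one
  having weight \<open>\<lambda>\<^sub>k / (d+1)\<close>; applying the matrix \<open>n\<close> times multiplies that weight by \<open>\<lambda>\<^sub>k\<^sup>n\<close>.\<close>

lemma dim_vec_cyclic_shift [simp]: "dim_vec (cyclic_shift x) = dim_vec x"
  by (simp add: cyclic_shift_def)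

lemma dim_vec_cyclic_shift_funpow [simp]: "dim_vec ((cyclic_shift ^^ i) x) = dim_vec x"
  by (induction i) auto

lemma cyclic_shift_index:
  "l < dim_vec x \<Longrightarrow> cyclic_shift x $ l = (if l = 0 then x $ (dim_vec x - 1) else x $ (l - 1))"
  by (simp add: cyclic_shift_def)

text \<open>Each shift moves entries one place right, so after \<open>i\<close> shifts exactly the
  first \<open>i\<close> positions hold wrapped entries. In the induction, position 0 reads the last
  position of the previous shift, which is not yet wrapped because \<open>i\<close> stays within the
  dimension.\<close>

lemma cyclic_shift_funpow_index:
  assumes "i \<le> dim_vec x" "l < dim_vec x"
  shows "(cyclic_shift ^^ i) x $ l = (if l < i then x $ (dim_vec x + l - i) else x $ (l - i))"
  using assms
proof (induction i arbitrary: l)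
  case (Suc i)
  show ?case
  proof (cases l)
    case 0
    then show ?thesis using Suc.IH[of "dim_vec x - 1"] Suc.prems by (auto simp: cyclic_shift_index)
  next
    case (Suc l')
    then show ?thesis using Suc.IH[of l'] Suc.prems by (auto simp: cyclic_shift_index)
  qed
qed simp

lemma circulant_mat_carrier: "circulant_mat p \<in> carrier_mat (degree p + 1) (degree p + 1)"
  by (simp add: circulant_mat_def)

text \<open>Position q of \<open>rev_coeff_vec p\<close> holds the coefficient of index d - q, where
  d is the degree; substituting the two cases of the shift formula for q gives the two
  branches.\<close>

lemma circulant_mat_index:
  assumes "i \<le> degree p" "l \<le> degree p"
  shows "circulant_mat p $$ (i, l) = coeff p (if l < i then i - l - 1 else degree p + i - l)"
proof -
  have "circulant_mat p $$ (i, l) = (cyclic_shift ^^ i) (rev_coeff_vec p) $ l"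
    using assms by (simp add: circulant_mat_def)
  also have "\<dots> = coeff p (if l < i then i - l - 1 else degree p + i - l)"
    using assms by (subst cyclic_shift_funpow_index)
      (auto simp: rev_coeff_vec_def intro!: arg_cong[of _ _ "coeff p"])
  finally show ?thesis .
qed

lemma circulant_mat_eigenvector:
  fixes \<omega> :: complex
  assumes \<omega>: "\<omega> ^ (degree p + 1) = 1" and i: "i \<le> degree p"
  shows "(\<Sum>l\<le>degree p. of_real (circulant_mat p $$ (i, l)) * \<omega> ^ (l + 1)) =
    (\<Sum>m\<le>degree p. of_real (coeff p m) * \<omega> ^ (degree p - m)) * \<omega> ^ (i + 1)"
proof -
  let ?d = "degree p"
  \<comment> \<open>For the fixed row \<open>i\<close>, \<open>s\<close> sends a column to the index
    of the coefficient found there. It reflects the columns below \<open>i\<close> among themselves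
    and likewise the remaining ones, so it is an involution and serves as its own inverse in the
    reindexing.\<close>
  define s where "s m = (if m < i then i - m - 1 else ?d + i - m)" for m
  have "(\<Sum>l\<le>?d. of_real (circulant_mat p $$ (i, l)) * \<omega> ^ (l + 1)) =
    (\<Sum>l\<le>?d. of_real (coeff p (s l)) * \<omega> ^ (l + 1))"
    using i by (intro sum.cong) (auto simp: circulant_mat_index s_def)
  also have "\<dots> = (\<Sum>m\<le>?d. of_real (coeff p m) * \<omega> ^ (?d - m) * \<omega> ^ (i + 1))"
  proof (rule sum.reindex_bij_witness[of _ s s])
    fix l assume l: "l \<in> {..?d}"
    show "s (s l) = l" "s l \<in> {..?d}" using l i by (auto simp: s_def)
    have "\<omega> ^ (?d - s l) * \<omega> ^ (i + 1) = \<omega> ^ (l + 1)"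
    proof (cases "l < i")
      case True
      \<comment> \<open>In a wrapped column the exponents differ by one full period, which the
        hypothesis on \<open>\<omega>\<close> absorbs; otherwise they agree exactly.\<close>
      then have "(?d - s l) + (i + 1) = (l + 1) + (?d + 1)"
        using i by (auto simp: s_def)
      then show ?thesis
        by (metis \<omega> power_add mult.right_neutral)
    next
      case False
      then have "(?d - s l) + (i + 1) = l + 1" using l i by (auto simp: s_def)
      then show ?thesis by (metis power_add)
    qed
    then show "complex_of_real (coeff p (s l)) * \<omega> ^ (?d - s l) * \<omega> ^ (i + 1) =
        of_real (coeff p (s l)) * \<omega> ^ (l + 1)"
      by (simp only: mult.assoc)
  qed (use i in \<open>auto simp: s_def\<close>)
  finally show ?thesis by (simp add: sum_distrib_right)
qed

lemma root_xi_power: "root_xi d ^ k = cis (2 * pi * real k / real (d + 1))"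
proof -
  have "root_xi d = cis (2 * pi / real (d + 1))"
    by (simp add: root_xi_def cis_conv_exp mult_ac)
  then show ?thesis by (simp add: DeMoivre mult_ac)
qed

lemma root_xi_power_order: "root_xi d ^ (d + 1) = 1"
  unfolding root_xi_power by simp

lemma root_xi_nonzero [simp]: "root_xi d \<noteq> 0"
  by (simp add: root_xi_def)

text \<open>In polar form these powers are the library's enumeration of the roots of unity of order
  \<open>d + 1\<close>, which is a bijection.\<close>

lemma root_xi_power_inj:
  assumes "j \<le> d" "m \<le> d" "root_xi d ^ j = root_xi d ^ m"
  shows "j = m"
  using bij_betw_imp_inj_on[OF bij_betw_roots_unity[of "d + 1"]] assms
  by (auto simp: inj_on_def root_xi_power)

text \<open>The sum is geometric with ratio \<xi> to the power j - m: the ratio is 1 if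
  \<open>m = j\<close>, and otherwise a root of unity different from 1, whose powers over a full
  period cancel.\<close>

lemma root_xi_orthogonality:
  assumes "j \<le> d" "m \<le> d"
  shows "(\<Sum>k\<le>d. root_xi d ^ ((j + 1) * k) * (root_xi d ^ k) ^ (d - m)) =
    (if m = j then of_nat (d + 1) else 0)"
proof -
  \<comment> \<open>Adding the period \<open>d + 1\<close> keeps the natural-number subtraction from
    truncating when \<open>j < m\<close>, without changing the power of \<xi>.\<close>
  let ?e = "j + (d + 1) - m"
  let ?z = "root_xi d ^ ?e"
  have z: "root_xi d ^ j = ?z * root_xi d ^ m"
  proof -
    have "?z * root_xi d ^ m = root_xi d ^ j * root_xi d ^ (d + 1)"
      using assms by (simp only: power_add[symmetric]) simp
    then show ?thesis by (simp only: root_xi_power_order) simp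
  qed
  have "(\<Sum>k\<le>d. root_xi d ^ ((j + 1) * k) * (root_xi d ^ k) ^ (d - m)) = (\<Sum>k<Suc d. ?z ^ k)"
  proof (rule sum.cong)
    fix k
    have "?e = (j + 1) + (d - m)" using assms by simp
    then have "(j + 1) * k + k * (d - m) = ?e * k"
      by (simp only: add_mult_distrib2 mult.commute)
    then show "root_xi d ^ ((j + 1) * k) * (root_xi d ^ k) ^ (d - m) = ?z ^ k"
      by (metis power_add power_mult)
  qed auto
  also have "\<dots> = (if m = j then of_nat (d + 1) else 0)"
  proof (cases "m = j")
    case True
    then have "?z = 1" using z by simp
    then show ?thesis using True by (simp only: power_one) simp
  next
    case False
    then have "?z \<noteq> 1" using z root_xi_power_inj[OF assms] by auto
    moreover have "?z ^ Suc d = 1"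
      by (metis root_xi_power_order Suc_eq_plus1 power_mult mult.commute power_one)
    ultimately show ?thesis using False geometric_sum[of ?z "Suc d"]
      by (simp del: sum.lessThan_Suc power_Suc)
  qed
  finally show ?thesis .
qed

text \<open>The prefactor has exponent d, at least every \<open>m\<close> in the sum, so it clears
  all negative powers; the result is the factor appearing in
  \<open>circulant_mat_eigenvector\<close>.\<close>

lemma circ_eigenvalue_eq_sum:
  "circ_eigenvalue p k =
    (\<Sum>m\<le>degree p. of_real (coeff p m) * (root_xi (degree p) ^ k) ^ (degree p - m))"
proof -
  let ?d = "degree p" and ?w = "root_xi (degree p) ^ k"
  have "circ_eigenvalue p k = ?w ^ ?d * poly (map_poly of_real p) (inverse ?w)"
    by (simp add: circ_eigenvalue_def power_int_minus mult.commute flip: power_mult)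
  also have "\<dots> = (\<Sum>m\<le>?d. of_real (coeff p m) * (?w ^ ?d * inverse ?w ^ m))"
    by (simp add: poly_altdef degree_map_poly coeff_map_poly sum_distrib_left mult_ac)
  also have "\<dots> = (\<Sum>m\<le>?d. of_real (coeff p m) * ?w ^ (?d - m))"
    by (intro sum.cong) (auto simp: power_diff field_simps)
  finally show ?thesis .
qed

lemma circulant_mat_power_coeff_vec_index:
  assumes "j \<le> degree p"
  shows "of_real ((circulant_mat p ^\<^sub>m n *\<^sub>v coeff_vec p) $ j) =
    (1 / of_nat (degree p + 1)) *
      (\<Sum>k\<le>degree p. root_xi (degree p) ^ ((j + 1) * k) * circ_eigenvalue p k ^ (n + 1))"
  using assms
proof (induction n arbitrary: j)
  case 0
  let ?d = "degree p" and ?x = "root_xi (degree p)"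
  \<comment> \<open>Expanding the eigenvalues and summing over \<open>k\<close> first exposes the
    orthogonality sum, which keeps only the term \<open>m = j\<close>.\<close>
  have "(\<Sum>k\<le>?d. ?x ^ ((j + 1) * k) * circ_eigenvalue p k) =
    (\<Sum>m\<le>?d. of_real (coeff p m) * (\<Sum>k\<le>?d. ?x ^ ((j + 1) * k) * (?x ^ k) ^ (?d - m)))"
    unfolding circ_eigenvalue_eq_sum sum_distrib_left
    by (subst sum.swap) (simp add: mult_ac)
  also have "\<dots> = (\<Sum>m\<le>?d. of_real (coeff p m) * (if m = j then of_nat (?d + 1) else 0))"
    using 0 by (intro sum.cong refl arg_cong2[of _ _ _ _ "(*)"] root_xi_orthogonality) auto
  also have "\<dots> = of_real (coeff p j) * of_nat (?d + 1)"
    using 0 by (simp add: if_distrib[of "\<lambda>y. _ * y"] sum.delta cong: if_cong)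
  finally have "(\<Sum>k\<le>?d. ?x ^ ((j + 1) * k) * circ_eigenvalue p k) =
    of_real (coeff p j) * of_nat (?d + 1)" .
  moreover have "(circulant_mat p ^\<^sub>m 0 *\<^sub>v coeff_vec p) $ j = coeff p j"
  proof -
    have "coeff_vec p \<in> carrier_vec (?d + 1)" by (simp add: coeff_vec_def)
    then have "circulant_mat p ^\<^sub>m 0 *\<^sub>v coeff_vec p = coeff_vec p"
      using circulant_mat_carrier[of p] by simp
    then show ?thesis using 0 by (simp add: coeff_vec_def)
  qed
  moreover have "(of_nat (?d + 1) :: complex) \<noteq> 0"
    by (simp only: of_nat_eq_0_iff)
  ultimately show ?case
    by (simp only: power_one_right add_0) (simp del: of_nat_Suc of_nat_add)
next
  case (Suc n)
  let ?d = "degree p" and ?x = "root_xi (degree p)" and ?V = "circulant_mat p"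
  let ?N = "of_nat (degree p + 1) :: complex" and ?l = "circ_eigenvalue p"
  let ?w = "?V ^\<^sub>m n *\<^sub>v coeff_vec p"
  have V: "?V \<in> carrier_mat (?d + 1) (?d + 1)" by (rule circulant_mat_carrier)
  have c: "coeff_vec p \<in> carrier_vec (?d + 1)" by (simp add: coeff_vec_def)
  have pow: "?V ^\<^sub>m n \<in> carrier_mat (?d + 1) (?d + 1)" using V by (rule pow_carrier_mat)
  have w: "?w \<in> carrier_vec (?d + 1)" using pow c by simp
  \<comment> \<open>\<open>pow_mat\<close> appends the new factor on the right; it is needed on the
    left, so that \<open>?V\<close> acts on the vector covered by the induction hypothesis.\<close>
  have comm: "?V ^\<^sub>m Suc n = ?V * ?V ^\<^sub>m n"
    using V
  proof (induction n)
    case (Suc n)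
    then show ?case
      by (metis assoc_mult_mat pow_carrier_mat pow_mat.simps(2))
  qed simp
  have "(?V ^\<^sub>m Suc n *\<^sub>v coeff_vec p) $ j = (?V *\<^sub>v ?w) $ j"
    unfolding comm using V pow c by (subst assoc_mult_mat_vec) auto
  also have "\<dots> = (\<Sum>l\<le>?d. ?V $$ (j, l) * ?w $ l)"
    using V w Suc.prems
    by (auto simp: scalar_prod_def atLeast0LessThan lessThan_Suc_atMost intro!: sum.cong)
  finally have "complex_of_real ((?V ^\<^sub>m Suc n *\<^sub>v coeff_vec p) $ j) =
      (\<Sum>l\<le>?d. of_real (?V $$ (j, l)) * of_real (?w $ l))"
    by simp
  also have "\<dots> = (\<Sum>l\<le>?d. of_real (?V $$ (j, l)) *
      ((1 / ?N) * (\<Sum>k\<le>?d. ?x ^ ((l + 1) * k) * ?l k ^ (n + 1))))"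
    using Suc.IH by (intro sum.cong refl arg_cong2[of _ _ _ _ "(*)"]) auto
  \<comment> \<open>After the swap the inner sum is row \<open>j\<close> of \<open>?V\<close>
    applied to the eigenvector with \<omega> equal to \<open>?x ^ k\<close>, which yields one more
    factor \<open>?l k\<close>.\<close>
  also have "\<dots> = (1 / ?N) * (\<Sum>k\<le>?d. ?l k ^ (n + 1) *
      (\<Sum>l\<le>?d. of_real (?V $$ (j, l)) * (?x ^ k) ^ (l + 1)))"
    unfolding sum_distrib_left
    by (subst sum.swap) (simp add: mult_ac power_mult[symmetric] del: power_Suc)
  also have "\<dots> = (1 / ?N) * (\<Sum>k\<le>?d. ?l k ^ (n + 1) * (?l k * (?x ^ k) ^ (j + 1)))"
  proof -
    have "(?x ^ k) ^ (?d + 1) = 1" for k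
      by (metis power_commutes power_mult mult.commute power_one root_xi_power_order)
    then show ?thesis
      using circulant_mat_eigenvector Suc.prems by (simp only: circ_eigenvalue_eq_sum)
  qed
  also have "\<dots> = (1 / ?N) * (\<Sum>k\<le>?d. ?x ^ ((j + 1) * k) * ?l k ^ (Suc n + 1))"
    by (simp add: mult_ac power_add flip: power_mult)
  finally show ?case .
qed

theorem theorem4:
  fixes d n :: nat and p :: "real poly"
  assumes "d \<ge> 1" and "degree p = d" and "coeff p 0 \<noteq> 0"
  shows "map_vec complex_of_real (circulant_mat p ^\<^sub>m n *\<^sub>v coeff_vec p) =
    (1 / of_nat (d + 1)) \<cdot>\<^sub>v
      (xi_mat d *\<^sub>v vec (d + 1) (\<lambda>k. circ_eigenvalue p k ^ (n + 1)))"
proof (rule eq_vecI)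
  have dim: "dim_row (circulant_mat p ^\<^sub>m n) = d + 1"
    using pow_carrier_mat[OF circulant_mat_carrier[of p], of n] assms(2)
    by (simp only: carrier_matD)
  then show "dim_vec (map_vec complex_of_real (circulant_mat p ^\<^sub>m n *\<^sub>v coeff_vec p)) =
    dim_vec ((1 / of_nat (d + 1)) \<cdot>\<^sub>v
      (xi_mat d *\<^sub>v vec (d + 1) (\<lambda>k. circ_eigenvalue p k ^ (n + 1))))"
    by (simp add: xi_mat_def)
  fix j
  assume "j < dim_vec ((1 / of_nat (d + 1)) \<cdot>\<^sub>v
      (xi_mat d *\<^sub>v vec (d + 1) (\<lambda>k. circ_eigenvalue p k ^ (n + 1))))"
  then have j: "j \<le> d" by (simp add: xi_mat_def)
  \<comment> \<open>Row \<open>j\<close> of \<open>xi_mat d\<close> written out as a scalar product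
    is the sum in the entrywise formula, so only the scalar factor remains to be matched.\<close>
  have "(xi_mat d *\<^sub>v vec (d + 1) (\<lambda>k. circ_eigenvalue p k ^ (n + 1))) $ j =
    (\<Sum>k\<le>d. root_xi d ^ ((j + 1) * k) * circ_eigenvalue p k ^ (n + 1))"
    using j by (auto simp: xi_mat_def scalar_prod_def atLeast0LessThan lessThan_Suc_atMost
        simp del: power_Suc intro!: sum.cong)
  then show "map_vec complex_of_real (circulant_mat p ^\<^sub>m n *\<^sub>v coeff_vec p) $ j =
    ((1 / of_nat (d + 1)) \<cdot>\<^sub>v
      (xi_mat d *\<^sub>v vec (d + 1) (\<lambda>k. circ_eigenvalue p k ^ (n + 1)))) $ j"
    using j dim circulant_mat_power_coeff_vec_index[of j p n] assms(2)
    by (simp add: xi_mat_def del: power_Suc index_mult_mat_vec)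
qed

end
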